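(* Let $G$ be a minimal weighted graph. Any two factorizations of $G$ into prime graphs are equivalent in the following sense: there is a bijection between the two families of factors such that corresponding factor graphs are isomorphic.
   Context: Graphs are finite, connected, undirected weighted graphs $G=(V,E,w)$ with $w:E\to\mathbb{R}_{>0}$; $d_G$ denotes the shortest-path metric (minimum total edge weight of a path). $G$ is minimal if $w(uv)=d_G(u,v)$ for every edge $uv\in E$. An isomorphism of weighted graphs is a bijection of vertices preserving adjacency, non-adjacency and edge weights. Cartesian product: for $G_i=(V_i,E_i,w_i)$, $1\le i\le m$, the graph $\prod_{i=1}^m G_i$ has vertex set $V_1\times\cdots\times V_m$; $(u_1,\dots,u_m)(v_1,\dots,v_m)$ is an edge iff there is exactly one index $\ell$ with $u_\ell v_\ell\in E_\ell$ and $u_i=v_i$ for all $i\ne\ell$, and its weight is then $w_\ell(u_\ell v_\ell)$. A finite family $\{G_1,\dots,G_m\}$ (repetitions allowed) is a factorization of $G$, with factors $G_i$, if $G$ is isomorphic to $\prod_{i=1}^m G_i$. By convention a factorization does not include the one-vertex graph $K_1$ unless $G=K_1$. $G$ is prime if every factorization of $G$ includes (a graph isomorphic to) $G$ as a factor.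
   Formalization: For G = K_1 the only factorization admitted is the single-member family {K_1}; read literally, {K_1} and {K_1, K_1} would both be prime factorizations of K_1 and uniqueness would fail. *)

theory Defs
  imports Complex_Main "HOL-Library.FuncSet"
begin

record 'a wgraph =
  verts :: "'a set"
  edges :: "'a set set"
  weight :: "'a set \<Rightarrow> real"  \<comment> \<open>only the values on edges are meaningful\<close>

definition is_path :: "'a wgraph \<Rightarrow> 'a \<Rightarrow> 'a list \<Rightarrow> 'a \<Rightarrow> bool" where
  "is_path G u p v \<longleftrightarrow>
     p \<noteq> [] \<and> hd p = u \<and> last p = v \<and> distinct p \<and> set p \<subseteq> verts G \<and>
     successively (\<lambda>x y. {x, y} \<in> edges G) p"

definition path_weight :: "'a wgraph \<Rightarrow> 'a list \<Rightarrow> real" where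
  "path_weight G p = (\<Sum>i<length p - 1. weight G {p ! i, p ! Suc i})"

text \<open>The minimum ranges over a finite set (paths do not repeat vertices), nonempty for
  vertices of a connected graph.\<close>

definition graph_dist :: "'a wgraph \<Rightarrow> 'a \<Rightarrow> 'a \<Rightarrow> real" where
  "graph_dist G u v = Min (path_weight G ` {p. is_path G u p v})"

locale weighted_graph =
  fixes G :: "'a wgraph"
  assumes finite_verts: "finite (verts G)"
    and verts_nonempty: "verts G \<noteq> {}"
    and edges_wf: "e \<in> edges G \<Longrightarrow> e \<subseteq> verts G \<and> card e = 2"
    and weight_pos: "e \<in> edges G \<Longrightarrow> 0 < weight G e"
    and connected: "u \<in> verts G \<Longrightarrow> v \<in> verts G \<Longrightarrow> \<exists>p. is_path G u p v"

definition minimal_graph :: "'a wgraph \<Rightarrow> bool" where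
  "minimal_graph G \<longleftrightarrow>
     (\<forall>u v. {u, v} \<in> edges G \<longrightarrow> weight G {u, v} = graph_dist G u v)"

definition graph_iso :: "'a wgraph \<Rightarrow> 'b wgraph \<Rightarrow> bool" (infix "\<simeq>\<^sub>g" 50) where
  "G \<simeq>\<^sub>g H \<longleftrightarrow>
     (\<exists>f. bij_betw f (verts G) (verts H) \<and>
          (\<forall>u\<in>verts G. \<forall>v\<in>verts G. {u, v} \<in> edges G \<longleftrightarrow> {f u, f v} \<in> edges H) \<and>
          (\<forall>u\<in>verts G. \<forall>v\<in>verts G. {u, v} \<in> edges G \<longrightarrow>
              weight H {f u, f v} = weight G {u, v}))"

text \<open>Vertices of the product are tuples indexed by \<open>I\<close>, i.e. extensional functions.
  The image of an edge \<open>{u, v}\<close> under the projection to coordinate \<open>l\<close> is \<open>{u l, v l}\<close>;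
  as edges have two elements, it is an edge of factor \<open>l\<close> only for the one coordinate
  in which \<open>u\<close> and \<open>v\<close> differ.\<close>

definition cart_prod :: "'i set \<Rightarrow> ('i \<Rightarrow> 'b wgraph) \<Rightarrow> ('i \<Rightarrow> 'b) wgraph" where
  "cart_prod I F =
     \<lparr> verts = (\<Pi>\<^sub>E i\<in>I. verts (F i)),
       edges = {{u, v} | u v. u \<in> (\<Pi>\<^sub>E i\<in>I. verts (F i)) \<and> v \<in> (\<Pi>\<^sub>E i\<in>I. verts (F i)) \<and>
                  (\<exists>!l. l \<in> I \<and> {u l, v l} \<in> edges (F l) \<and> (\<forall>i\<in>I - {l}. u i = v i))},
       weight = (\<lambda>e. let l = (THE l. l \<in> I \<and> (\<lambda>x. x l) ` e \<in> edges (F l))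
                      in weight (F l) ((\<lambda>x. x l) ` e)) \<rparr>"

definition is_K1 :: "'a wgraph \<Rightarrow> bool" where
  "is_K1 G \<longleftrightarrow> card (verts G) = 1"

text \<open>The family consists of \<open>F 1, \<dots>, F m\<close>. The one-vertex graph is a factor only in the
  trivial factorization of \<open>K\<^sub>1\<close> by itself: were \<open>{K\<^sub>1, K\<^sub>1}\<close> also admitted as a factorization
  of \<open>K\<^sub>1\<close>, uniqueness of the number of factors would fail for that graph.\<close>

definition is_factorization :: "'a wgraph \<Rightarrow> nat \<Rightarrow> (nat \<Rightarrow> 'b wgraph) \<Rightarrow> bool" where
  "is_factorization G m F \<longleftrightarrow>
     1 \<le> m \<and>
     (\<forall>i\<in>{1..m}. weighted_graph (F i)) \<and>
     G \<simeq>\<^sub>g cart_prod {1..m} F \<and>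
     ((\<exists>i\<in>{1..m}. is_K1 (F i)) \<longrightarrow> is_K1 G \<and> m = 1)"

text \<open>Quantifying over factors with vertices in \<^typ>\<open>nat\<close> is no restriction: every finite
  graph is isomorphic to one of these.\<close>

definition prime_graph :: "'a wgraph \<Rightarrow> bool" where
  "prime_graph G \<longleftrightarrow>
     weighted_graph G \<and>
     (\<forall>m (F :: nat \<Rightarrow> nat wgraph). is_factorization G m F \<longrightarrow> (\<exists>i\<in>{1..m}. F i \<simeq>\<^sub>g G))"

end

theory Submission
  imports Defs
begin

text \<open>
  The number of edges on a shortest path is a metric that is additive over the coordinates of
  any factorization. Hence the layers of a factorization are convex, and a convex
  set of vertices is a box in the coordinates of every factorization. So a layer of the first
  factorization through a vertex \<open>a\<close> is a box in the coordinates of the second one; being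
  prime, it varies in one coordinate only, that is, it lies in a layer of the second
  factorization. By symmetry the layers through \<open>a\<close> of both factorizations coincide.
\<close>

section \<open>Adjacency, hop distance and convexity\<close>

text \<open>A convex set is a box because a vertex each of whose coordinates comes from one of two
  members lies on a shortest path between them, so members can exchange coordinates freely; and a
  box inherits the product structure, which lets primality act on it. The obstacle is the form of
  primality: \<open>prime_graph\<close> quantifies over families of graphs with vertices in
  \<open>nat\<close>, indexed by \<open>{1..m}\<close> and with K1 all but excluded, whereas the box
  cut out by a layer has arbitrary vertices and, as it turns out, one-vertex factors in all
  coordinates but one. Coordinates are therefore handled over arbitrary index sets and vertex types;
  only where primality is applied are trivial factors dropped and the others renumbered and
  relabelled.\<close>

definition adj :: "'a wgraph \<Rightarrow> ('a \<times> 'a) set" where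
  "adj G = {(u, v). {u, v} \<in> edges G}"

text \<open>Edges are counted along walks, not along repetition-free paths: powers of a relation
  compose, which makes the triangle inequality immediate.\<close>

definition hop_dist :: "'a wgraph \<Rightarrow> 'a \<Rightarrow> 'a \<Rightarrow> nat" where
  "hop_dist G u v = (LEAST n. (u, v) \<in> adj G ^^ n)"

text \<open>Geodesic convexity: a vertex lies on a shortest path from \<open>u\<close> to
  \<open>v\<close> exactly when the triangle inequality through it is an equality.\<close>

definition convex_verts :: "'a wgraph \<Rightarrow> 'a set \<Rightarrow> bool" where
  "convex_verts G S \<longleftrightarrow> S \<subseteq> verts G \<and>
     (\<forall>u\<in>S. \<forall>v\<in>S. \<forall>x\<in>verts G. hop_dist G u x + hop_dist G x v = hop_dist G u v \<longrightarrow> x \<in> S)"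

definition induced_subgraph :: "'a wgraph \<Rightarrow> 'a set \<Rightarrow> 'a wgraph" where
  "induced_subgraph G S =
     \<lparr> verts = S, edges = {e \<in> edges G. e \<subseteq> S}, weight = weight G \<rparr>"

lemma induced_subgraph_simps [simp]:
  "verts (induced_subgraph G S) = S"
  "e \<in> edges (induced_subgraph G S) \<longleftrightarrow> e \<in> edges G \<and> e \<subseteq> S"
  "weight (induced_subgraph G S) = weight G"
  by (auto simp: induced_subgraph_def)

lemma is_path_imp_rtrancl_adj:
  assumes "is_path G u p v"
  shows "(u, v) \<in> (adj G)\<^sup>*"
proof -
  have "p \<noteq> [] \<Longrightarrow> successively (\<lambda>x y. {x, y} \<in> edges G) p \<Longrightarrow> (hd p, last p) \<in> (adj G)\<^sup>*"
  proof (induction p)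
    case (Cons x p)
    then show ?case
      by (cases p) (auto simp: adj_def intro: converse_rtrancl_into_rtrancl)
  qed simp
  then show ?thesis using assms by (auto simp: is_path_def)
qed

text \<open>Paths must not repeat vertices, so when a walk returns to a vertex of the path built so
  far, the path is cut off there.\<close>

lemma rtrancl_adj_imp_is_path:
  assumes "(u, v) \<in> (adj G)\<^sup>*" "u \<in> verts G" "\<And>e. e \<in> edges G \<Longrightarrow> e \<subseteq> verts G"
  shows "\<exists>p. is_path G u p v"
  using assms(1)
proof (induction rule: rtrancl_induct)
  case base
  have "is_path G u [u] u" using assms(2) by (simp add: is_path_def)
  then show ?case ..
next
  case (step v w)
  then obtain p where p: "is_path G u p v" by blast
  have w: "w \<in> verts G" and e: "{v, w} \<in> edges G"
    using step(2) assms(3) by (auto simp: adj_def)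
  show ?case
  proof (cases "w \<in> set p")
    case True
    then obtain xs ys where xy: "p = xs @ w # ys" by (auto simp: in_set_conv_decomp)
    have "is_path G u (xs @ [w]) w"
      using p xy
      by (cases xs) (auto simp: is_path_def successively_append_iff successively_Cons hd_append
          split: if_splits)
    then show ?thesis ..
  next
    case False
    have "is_path G u (p @ [w]) w"
      using p False w e by (auto simp: is_path_def successively_append_iff)
    then show ?thesis ..
  qed
qed

lemma is_K1_iff_eq:
  assumes "x \<in> verts G"
  shows "is_K1 G \<longleftrightarrow> verts G = {x}"
  using assms by (auto simp: is_K1_def card_1_singleton_iff)

context weighted_graph
begin

lemma adjD: "(u, v) \<in> adj G \<Longrightarrow> u \<in> verts G \<and> v \<in> verts G \<and> u \<noteq> v"
  using edges_wf[of "{u, v}"] by (auto simp: adj_def)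

lemma edgeD:
  assumes "{u, v} \<in> edges G"
  shows "u \<in> verts G" "v \<in> verts G" "u \<noteq> v"
  using adjD[of u v] assms by (auto simp: adj_def)

lemma relpow_adj_hop_dist:
  assumes "u \<in> verts G" "v \<in> verts G"
  shows "(u, v) \<in> adj G ^^ hop_dist G u v"
proof -
  obtain n where "(u, v) \<in> adj G ^^ n"
    using connected[OF assms] is_path_imp_rtrancl_adj rtrancl_imp_relpow by metis
  then show ?thesis unfolding hop_dist_def by (rule LeastI)
qed

lemma hop_dist_le: "(u, v) \<in> adj G ^^ n \<Longrightarrow> hop_dist G u v \<le> n"
  unfolding hop_dist_def by (rule Least_le)

lemma hop_dist_self [simp]: "hop_dist G u u = 0"
  using hop_dist_le[of u u 0] by simp

lemma hop_dist_eq_0_iff: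
  assumes "u \<in> verts G" "v \<in> verts G"
  shows "hop_dist G u v = 0 \<longleftrightarrow> u = v"
  using relpow_adj_hop_dist[OF assms] by auto

lemma hop_dist_triangle:
  assumes "u \<in> verts G" "v \<in> verts G" "w \<in> verts G"
  shows "hop_dist G u w \<le> hop_dist G u v + hop_dist G v w"
  using relpow_adj_hop_dist assms by (intro hop_dist_le) (auto simp: relpow_add)

lemma hop_dist_edge: "{u, v} \<in> edges G \<Longrightarrow> hop_dist G u v \<le> 1"
  using hop_dist_le[of u v 1] by (simp add: adj_def)

text \<open>\<open>x\<close> is the second vertex of a shortest walk. This is the induction step
  both for the connectedness of convex sets and for the additivity of the distance.\<close>

lemma hop_dist_step:
  assumes "u \<in> verts G" "v \<in> verts G" "u \<noteq> v"
  obtains x where "{u, x} \<in> edges G" "hop_dist G u v = Suc (hop_dist G x v)"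
proof -
  obtain k where k: "hop_dist G u v = Suc k"
    using hop_dist_eq_0_iff assms not0_implies_Suc by metis
  then have "(u, v) \<in> adj G ^^ Suc k" using relpow_adj_hop_dist assms by metis
  then obtain x where x: "(u, x) \<in> adj G" "(x, v) \<in> adj G ^^ k"
    by (rule relpow_Suc_E2)
  have "hop_dist G u v \<le> hop_dist G u x + hop_dist G x v"
    using hop_dist_triangle adjD[OF x(1)] assms by blast
  then have "hop_dist G u v \<le> Suc (hop_dist G x v)"
    using hop_dist_edge[of u x] x(1) by (simp add: adj_def)
  then have "hop_dist G u v = Suc (hop_dist G x v)"
    using hop_dist_le[OF x(2)] k by simp
  then show ?thesis using that x(1) by (auto simp: adj_def)
qed

lemma weighted_graph_induced_subgraph:
  assumes "S \<subseteq> verts G" "S \<noteq> {}"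
    and "\<And>u v. u \<in> S \<Longrightarrow> v \<in> S \<Longrightarrow> (u, v) \<in> (adj (induced_subgraph G S))\<^sup>*"
  shows "weighted_graph (induced_subgraph G S)"
proof
  show "finite (verts (induced_subgraph G S))"
    using assms(1) finite_verts finite_subset by auto
  show "\<exists>p. is_path (induced_subgraph G S) u p v"
    if "u \<in> verts (induced_subgraph G S)" "v \<in> verts (induced_subgraph G S)" for u v
    using that assms(3) by (intro rtrancl_adj_imp_is_path) auto
qed (use assms edges_wf weight_pos in auto)

text \<open>Only connectedness is at stake: the first step of a shortest walk towards
  \<open>v\<close> stays in \<open>S\<close> by convexity, and the distance to \<open>v\<close>
  drops.\<close>

lemma weighted_graph_convex:
  assumes S: "convex_verts G S" and "S \<noteq> {}"
  shows "weighted_graph (induced_subgraph G S)"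
proof (rule weighted_graph_induced_subgraph)
  show SV: "S \<subseteq> verts G" using S by (simp add: convex_verts_def)
  fix u v assume "u \<in> S" "v \<in> S"
  then show "(u, v) \<in> (adj (induced_subgraph G S))\<^sup>*"
  proof (induction "hop_dist G u v" arbitrary: u rule: less_induct)
    case less
    show ?case
    proof (cases "u = v")
      case False
      then obtain x where x: "{u, x} \<in> edges G" "hop_dist G u v = Suc (hop_dist G x v)"
        using hop_dist_step less.prems SV by blast
      have V: "u \<in> verts G" "x \<in> verts G" "v \<in> verts G"
        using edgeD[OF x(1)] less.prems SV by auto
      then have "hop_dist G u x + hop_dist G x v = hop_dist G u v"
        using hop_dist_triangle[of u x v] hop_dist_edge[OF x(1)] x(2) by simp
      then have "x \<in> S" using S less.prems V(2) unfolding convex_verts_def by blast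
      moreover have "(u, x) \<in> adj (induced_subgraph G S)"
        using x(1) \<open>x \<in> S\<close> less.prems by (simp add: adj_def)
      ultimately show ?thesis
        using less.hyps[of x] x(2) less.prems by (simp add: converse_rtrancl_into_rtrancl)
    qed simp
  qed
qed (use assms in simp)

end

section \<open>Isomorphisms\<close>

lemma graph_iso_trans [trans]:
  assumes "G \<simeq>\<^sub>g H" "H \<simeq>\<^sub>g K"
  shows "G \<simeq>\<^sub>g K"
proof -
  obtain f where f: "bij_betw f (verts G) (verts H)"
    "\<And>u v. u \<in> verts G \<Longrightarrow> v \<in> verts G \<Longrightarrow> {u, v} \<in> edges G \<longleftrightarrow> {f u, f v} \<in> edges H"
    "\<And>u v. u \<in> verts G \<Longrightarrow> v \<in> verts G \<Longrightarrow> {u, v} \<in> edges G \<Longrightarrow>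
        weight H {f u, f v} = weight G {u, v}"
    using assms(1) unfolding graph_iso_def by metis
  obtain g where g: "bij_betw g (verts H) (verts K)"
    "\<And>u v. u \<in> verts H \<Longrightarrow> v \<in> verts H \<Longrightarrow> {u, v} \<in> edges H \<longleftrightarrow> {g u, g v} \<in> edges K"
    "\<And>u v. u \<in> verts H \<Longrightarrow> v \<in> verts H \<Longrightarrow> {u, v} \<in> edges H \<Longrightarrow>
        weight K {g u, g v} = weight H {u, v}"
    using assms(2) unfolding graph_iso_def by metis
  have "f u \<in> verts H" if "u \<in> verts G" for u
    using f(1) that by (auto simp: bij_betw_def)
  then show ?thesis
    unfolding graph_iso_def using f g
    by (intro exI[of _ "g \<circ> f"]) (auto intro: bij_betw_trans)
qed

lemma graph_iso_sym:
  assumes "G \<simeq>\<^sub>g H"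
  shows "H \<simeq>\<^sub>g G"
proof -
  obtain f where f: "bij_betw f (verts G) (verts H)"
    "\<And>u v. u \<in> verts G \<Longrightarrow> v \<in> verts G \<Longrightarrow> {u, v} \<in> edges G \<longleftrightarrow> {f u, f v} \<in> edges H"
    "\<And>u v. u \<in> verts G \<Longrightarrow> v \<in> verts G \<Longrightarrow> {u, v} \<in> edges G \<Longrightarrow>
        weight H {f u, f v} = weight G {u, v}"
    using assms(1) unfolding graph_iso_def by metis
  let ?g = "inv_into (verts G) f"
  have g: "?g x \<in> verts G" "f (?g x) = x" if "x \<in> verts H" for x
    using that f(1) by (auto simp: bij_betw_def inv_into_into f_inv_into_f)
  show ?thesis
    unfolding graph_iso_def
    using bij_betw_inv_into[OF f(1)] f(2,3) g
    by (intro exI[of _ ?g]) (metis (no_types, lifting))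
qed

lemma graph_iso_card_verts: "G \<simeq>\<^sub>g H \<Longrightarrow> card (verts G) = card (verts H)"
  unfolding graph_iso_def using bij_betw_same_card by blast

text \<open>A copy of \<open>G\<close> with vertices renamed by \<open>e\<close>, meant for
  \<open>e\<close> injective on the vertices. It moves factors to the vertex type \<open>nat\<close>
  over which \<open>prime_graph\<close> quantifies.\<close>

definition map_graph :: "('a \<Rightarrow> 'b) \<Rightarrow> 'a wgraph \<Rightarrow> 'b wgraph" where
  "map_graph e G = \<lparr> verts = e ` verts G, edges = (`) e ` edges G,
     weight = (\<lambda>s. weight G (inv_into (verts G) e ` s)) \<rparr>"

lemma map_graph_edge_iff:
  assumes "weighted_graph G" "inj_on e (verts G)" "u \<in> verts G" "v \<in> verts G"
  shows "{e u, e v} \<in> edges (map_graph e G) \<longleftrightarrow> {u, v} \<in> edges G"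
proof -
  interpret weighted_graph G by fact
  have "d = {u, v}" if "d \<in> edges G" "e ` d = {e u, e v}" for d
    using inj_on_image_eq_iff[OF assms(2), of d "{u, v}"] edges_wf[OF that(1)] that assms by auto
  moreover have "{e u, e v} \<in> (`) e ` edges G" if "{u, v} \<in> edges G"
    using imageI[OF that, of "(`) e"] by simp
  ultimately have "{e u, e v} \<in> (`) e ` edges G \<longleftrightarrow> {u, v} \<in> edges G"
    by (metis (no_types, lifting) imageE)
  then show ?thesis by (simp add: map_graph_def)
qed

lemma map_graph_weight:
  assumes "inj_on e (verts G)" "d \<subseteq> verts G"
  shows "weight (map_graph e G) (e ` d) = weight G d"
  using assms by (simp add: map_graph_def)

lemma weighted_graph_map_graph:
  assumes "weighted_graph G" "inj_on e (verts G)"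
  shows "weighted_graph (map_graph e G)"
proof -
  interpret weighted_graph G by fact
  show ?thesis
  proof
    fix d assume "d \<in> edges (map_graph e G)"
    then obtain d' where d: "d = e ` d'" "d' \<in> edges G" by (auto simp: map_graph_def)
    have "inj_on e d'" using edges_wf[OF d(2)] assms(2) inj_on_subset by blast
    then show "d \<subseteq> verts (map_graph e G) \<and> card d = 2"
      using edges_wf[OF d(2)] by (auto simp: d card_image map_graph_def)
    show "0 < weight (map_graph e G) d"
      using map_graph_weight[OF assms(2)] edges_wf[OF d(2)] weight_pos[OF d(2)] d by auto
  next
    fix u v assume "u \<in> verts (map_graph e G)" "v \<in> verts (map_graph e G)"
    then obtain x y where xy: "u = e x" "v = e y" "x \<in> verts G" "y \<in> verts G"
      by (auto simp: map_graph_def)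
    obtain p where p: "is_path G x p y" using connected xy by blast
    have "successively (\<lambda>x y. {e x, e y} \<in> edges (map_graph e G)) p"
      using p map_graph_edge_iff[OF assms]
      by (auto simp: is_path_def subset_iff intro: successively_mono)
    then have "is_path (map_graph e G) u (map e p) v"
      using p xy assms(2)
      by (auto simp: is_path_def hd_map last_map distinct_map successively_map map_graph_def
          intro: inj_on_subset)
    then show "\<exists>p. is_path (map_graph e G) u p v" ..
  qed (use finite_verts verts_nonempty in \<open>auto simp: map_graph_def\<close>)
qed

section \<open>Coordinates of a factorization\<close>

text \<open>An isomorphism onto a product, unpacked: \<open>f v i\<close> is the coordinate of
  \<open>v\<close> at \<open>i\<close>. Unique existence and the description operator of
  \<open>cart_prod\<close> are gone, and index and vertex types are free, so that the same facts
  apply to boxes.\<close>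

locale product_coordinates = G: weighted_graph G
  for G :: "'a wgraph" +
  fixes I :: "'i set" and F :: "'i \<Rightarrow> 'b wgraph" and f :: "'a \<Rightarrow> 'i \<Rightarrow> 'b"
  assumes finite_index: "finite I"
    and factor: "i \<in> I \<Longrightarrow> weighted_graph (F i)"
    and bij: "bij_betw f (verts G) (\<Pi>\<^sub>E i\<in>I. verts (F i))"
    and edge_iff: "u \<in> verts G \<Longrightarrow> v \<in> verts G \<Longrightarrow> {u, v} \<in> edges G \<longleftrightarrow>
          (\<exists>l\<in>I. {f u l, f v l} \<in> edges (F l) \<and> (\<forall>i\<in>I - {l}. f u i = f v i))"
    and weight_eq: "{u, v} \<in> edges G \<Longrightarrow> l \<in> I \<Longrightarrow> {f u l, f v l} \<in> edges (F l) \<Longrightarrow>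
          weight (F l) {f u l, f v l} = weight G {u, v}"

text \<open>Factors have no loops, so a coordinate that carries an edge is one in which the end
  points differ, and there is only one of these; hence existence implies unique existence.\<close>

lemma cart_prod_edge_iff:
  assumes "\<And>i. i \<in> I \<Longrightarrow> weighted_graph (F i)"
    and "x \<in> (\<Pi>\<^sub>E i\<in>I. verts (F i))" "y \<in> (\<Pi>\<^sub>E i\<in>I. verts (F i))"
  shows "{x, y} \<in> edges (cart_prod I F) \<longleftrightarrow>
    (\<exists>l\<in>I. {x l, y l} \<in> edges (F l) \<and> (\<forall>i\<in>I - {l}. x i = y i))" (is "_ \<longleftrightarrow> ?R x y")
proof -
  have uniq: "k = l" if "{u l, v l} \<in> edges (F l)" "\<forall>i\<in>I - {k}. u i = v i" "l \<in> I"
    for u v :: "'a \<Rightarrow> 'b" and k l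
    using weighted_graph.edgeD(3)[OF assms(1) that(1)] that by auto
  have ex1: "(\<exists>!l. l \<in> I \<and> {u l, v l} \<in> edges (F l) \<and> (\<forall>i\<in>I - {l}. u i = v i)) \<longleftrightarrow> ?R u v"
    for u v :: "'a \<Rightarrow> 'b"
  proof
    assume "?R u v"
    then obtain l where l: "l \<in> I" "{u l, v l} \<in> edges (F l)" "\<forall>i\<in>I - {l}. u i = v i" by blast
    then show "\<exists>!l. l \<in> I \<and> {u l, v l} \<in> edges (F l) \<and> (\<forall>i\<in>I - {l}. u i = v i)"
      by (intro ex1I[of _ l]) (use uniq in blast)+
  qed blast
  have sym: "?R u v \<longleftrightarrow> ?R v u" for u v :: "'a \<Rightarrow> 'b"
    by (metis insert_commute)
  let ?V = "\<Pi>\<^sub>E i\<in>I. verts (F i)"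
  have "{x, y} \<in> edges (cart_prod I F) \<longleftrightarrow> (\<exists>u v. {x, y} = {u, v} \<and> u \<in> ?V \<and> v \<in> ?V \<and> ?R u v)"
    by (simp add: cart_prod_def ex1)
  also have "\<dots> \<longleftrightarrow> ?R x y \<or> ?R y x"
    using assms(2,3) unfolding doubleton_eq_iff by blast
  finally show ?thesis using sym by blast
qed

lemma cart_prod_weight:
  assumes "\<And>i. i \<in> I \<Longrightarrow> weighted_graph (F i)"
    and "l \<in> I" "{x l, y l} \<in> edges (F l)" "\<forall>i\<in>I - {l}. x i = y i"
  shows "weight (cart_prod I F) {x, y} = weight (F l) {x l, y l}"
proof -
  have "(THE l. l \<in> I \<and> (\<lambda>z. z l) ` {x, y} \<in> edges (F l)) = l"
  proof (rule the_equality)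
    fix k assume "k \<in> I \<and> (\<lambda>z. z k) ` {x, y} \<in> edges (F k)"
    then have "k \<in> I" "x k \<noteq> y k"
      using weighted_graph.edgeD(3)[OF assms(1), of k "x k" "y k"] by auto
    then show "k = l" using assms by auto
  qed (use assms in simp)
  then show ?thesis by (simp add: cart_prod_def Let_def)
qed

lemma product_coordinates_if_graph_iso:
  assumes "weighted_graph G" "finite I" "\<And>i. i \<in> I \<Longrightarrow> weighted_graph (F i)"
    and "G \<simeq>\<^sub>g cart_prod I F"
  obtains f where "product_coordinates G I F f"
proof -
  interpret weighted_graph G by fact
  obtain f where f: "bij_betw f (verts G) (\<Pi>\<^sub>E i\<in>I. verts (F i))"
    "\<And>u v. u \<in> verts G \<Longrightarrow> v \<in> verts G \<Longrightarrow>
        {u, v} \<in> edges G \<longleftrightarrow> {f u, f v} \<in> edges (cart_prod I F)"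
    "\<And>u v. u \<in> verts G \<Longrightarrow> v \<in> verts G \<Longrightarrow> {u, v} \<in> edges G \<Longrightarrow>
        weight (cart_prod I F) {f u, f v} = weight G {u, v}"
    using assms(4) unfolding graph_iso_def by (auto simp: cart_prod_def)
  have mem: "f u \<in> (\<Pi>\<^sub>E i\<in>I. verts (F i))" if "u \<in> verts G" for u
    using f(1) that by (auto simp: bij_betw_def)
  have E: "{u, v} \<in> edges G \<longleftrightarrow>
      (\<exists>l\<in>I. {f u l, f v l} \<in> edges (F l) \<and> (\<forall>i\<in>I - {l}. f u i = f v i))"
    if "u \<in> verts G" "v \<in> verts G" for u v
    using f(2)[OF that] cart_prod_edge_iff[OF assms(3) mem[OF that(1)] mem[OF that(2)]] by simp
  have W: "weight (F l) {f u l, f v l} = weight G {u, v}"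
    if uv: "{u, v} \<in> edges G" and l: "l \<in> I" "{f u l, f v l} \<in> edges (F l)" for u v l
  proof -
    note V = edgeD(1,2)[OF uv]
    obtain k where k: "k \<in> I" "{f u k, f v k} \<in> edges (F k)" "\<forall>i\<in>I - {k}. f u i = f v i"
      using E[OF V] uv by blast
    \<comment> \<open>The end points of an edge of \<open>F l\<close> are distinct, and
      \<open>f u\<close> and \<open>f v\<close> differ at \<open>k\<close> only.\<close>
    have "l = k" using k l weighted_graph.edgeD(3)[OF assms(3) l(2)] by auto
    then show ?thesis using cart_prod_weight[of I F k "f u" "f v"] assms(3) k f(3)[OF V uv] by simp
  qed
  have "product_coordinates G I F f"
    by (intro product_coordinates.intro product_coordinates_axioms.intro) (use assms f(1) E W in auto)
  then show ?thesis by (rule that)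
qed

context product_coordinates
begin

lemma coord_mem: "u \<in> verts G \<Longrightarrow> i \<in> I \<Longrightarrow> f u i \<in> verts (F i)"
  using bij by (auto simp: bij_betw_def)

lemma coord_eqI:
  assumes "u \<in> verts G" "v \<in> verts G" "\<And>i. i \<in> I \<Longrightarrow> f u i = f v i"
  shows "u = v"
proof -
  have "f u \<in> (\<Pi>\<^sub>E i\<in>I. verts (F i))" "f v \<in> (\<Pi>\<^sub>E i\<in>I. verts (F i))"
    using bij assms by (auto simp: bij_betw_def)
  then have "f u = f v" using assms(3) by (rule PiE_ext)
  then show ?thesis using bij assms by (auto simp: bij_betw_def inj_on_def)
qed

lemma vertex_with_coords:
  assumes "\<And>i. i \<in> I \<Longrightarrow> x i \<in> verts (F i)"
  obtains u where "u \<in> verts G" "\<And>i. i \<in> I \<Longrightarrow> f u i = x i"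
proof -
  have "restrict x I \<in> f ` verts G" using bij assms by (auto simp: bij_betw_def)
  then show ?thesis using that by (metis imageE restrict_apply')
qed

lemma edge_coord:
  assumes "{u, v} \<in> edges G"
  obtains l where "l \<in> I" "{f u l, f v l} \<in> edges (F l)" "\<And>i. i \<in> I \<Longrightarrow> i \<noteq> l \<Longrightarrow> f u i = f v i"
  using edge_iff[OF G.edgeD(1,2)[OF assms]] assms that by auto

lemma graph_iso_cart_prod: "G \<simeq>\<^sub>g cart_prod I F"
proof -
  have mem: "f u \<in> (\<Pi>\<^sub>E i\<in>I. verts (F i))" if "u \<in> verts G" for u
    using bij that by (auto simp: bij_betw_def)
  have "weight (cart_prod I F) {f u, f v} = weight G {u, v}" if uv: "{u, v} \<in> edges G" for u v
  proof -
    obtain l where l: "l \<in> I" "{f u l, f v l} \<in> edges (F l)"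
        "\<And>i. i \<in> I \<Longrightarrow> i \<noteq> l \<Longrightarrow> f u i = f v i"
      using edge_coord[OF uv] by blast
    then show ?thesis
      using cart_prod_weight[of I F l "f u" "f v"] factor weight_eq[OF uv] by simp
  qed
  moreover have "{u, v} \<in> edges G \<longleftrightarrow> {f u, f v} \<in> edges (cart_prod I F)"
    if "u \<in> verts G" "v \<in> verts G" for u v
    using edge_iff[OF that] cart_prod_edge_iff[OF factor mem[OF that(1)] mem[OF that(2)]] by simp
  moreover have "bij_betw f (verts G) (verts (cart_prod I F))"
    using bij by (simp add: cart_prod_def)
  ultimately show ?thesis unfolding graph_iso_def by blast
qed

lemma card_verts: "card (verts G) = (\<Prod>i\<in>I. card (verts (F i)))"
  using bij_betw_same_card[OF bij] card_PiE[OF finite_index] by simp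

section \<open>Additivity of the distance\<close>

text \<open>An edge of \<open>G\<close> is an edge in one coordinate and constant in the others.
  Upper bound: spend the sum one step at a time, in any coordinate that still differs. Lower bound:
  each edge of a walk raises the sum by at most one.\<close>

lemma hop_dist_eq_sum:
  assumes "u \<in> verts G" "v \<in> verts G"
  shows "hop_dist G u v = (\<Sum>i\<in>I. hop_dist (F i) (f u i) (f v i))"
proof (rule antisym)
  have "(u, v) \<in> adj G ^^ n"
    if "u \<in> verts G" "v \<in> verts G" "(\<Sum>i\<in>I. hop_dist (F i) (f u i) (f v i)) = n" for u v n
    using that
  proof (induction n arbitrary: u)
    case 0
    then have "f u i = f v i" if "i \<in> I" for i
      using that finite_index weighted_graph.hop_dist_eq_0_iff[OF factor] coord_mem by auto
    then show ?case using coord_eqI 0 by simp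
  next
    case (Suc n)
    have "\<exists>k\<in>I. hop_dist (F k) (f u k) (f v k) \<noteq> 0"
    proof (rule ccontr)
      assume "\<not> ?thesis"
      then have "(\<Sum>i\<in>I. hop_dist (F i) (f u i) (f v i)) = 0" by simp
      then show False using Suc.prems(3) by simp
    qed
    then obtain k where k: "k \<in> I" "hop_dist (F k) (f u k) (f v k) \<noteq> 0" by blast
    interpret Fk: weighted_graph "F k" using k factor by blast
    have "f u k \<noteq> f v k" using k by auto
    then obtain x where x: "{f u k, x} \<in> edges (F k)"
        "hop_dist (F k) (f u k) (f v k) = Suc (hop_dist (F k) x (f v k))"
      using Fk.hop_dist_step coord_mem k(1) Suc.prems(1,2) by metis
    \<comment> \<open>\<open>w\<close> makes the first step of a shortest walk in coordinate
      \<open>k\<close> and copies \<open>u\<close> elsewhere.\<close>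
    obtain w where w: "w \<in> verts G" "\<And>i. i \<in> I \<Longrightarrow> f w i = (if i = k then x else f u i)"
      using vertex_with_coords[of "\<lambda>i. if i = k then x else f u i"]
        coord_mem[OF Suc.prems(1)] Fk.edgeD(2)[OF x(1)] by metis
    have "{u, w} \<in> edges G"
      using edge_iff[OF Suc.prems(1) w(1)] w(2) k(1) x(1) by auto
    moreover have "(\<Sum>i\<in>I. hop_dist (F i) (f w i) (f v i)) = n"
    proof -
      have "(\<Sum>i\<in>I - {k}. hop_dist (F i) (f w i) (f v i)) =
          (\<Sum>i\<in>I - {k}. hop_dist (F i) (f u i) (f v i))"
        using w(2) by (intro sum.cong) auto
      then show ?thesis
        using Suc.prems(3) k(1) x(2) w(2)
        by (simp add: sum.remove[OF finite_index k(1)])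
    qed
    ultimately show ?case
      using Suc.IH[OF w(1) Suc.prems(2)] relpow_Suc_I2[of u w "adj G" v n]
      by (simp add: adj_def)
  qed
  then show "hop_dist G u v \<le> (\<Sum>i\<in>I. hop_dist (F i) (f u i) (f v i))"
    using assms by (intro G.hop_dist_le) auto
next
  have "(\<Sum>i\<in>I. hop_dist (F i) (f u i) (f v i)) \<le> n"
    if "(u, v) \<in> adj G ^^ n" "u \<in> verts G" for v n
    using that
  proof (induction n arbitrary: v)
    case 0
    have "hop_dist (F i) (f u i) (f u i) = 0" if "i \<in> I" for i
      using weighted_graph.hop_dist_self[OF factor] that by blast
    then show ?case using 0 by simp
  next
    case (Suc n)
    then obtain w where w: "(u, w) \<in> adj G ^^ n" "(w, v) \<in> adj G" by auto
    have V: "w \<in> verts G" "v \<in> verts G" using G.adjD[OF w(2)] by auto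
    obtain l where l: "l \<in> I" "{f w l, f v l} \<in> edges (F l)"
        "\<And>i. i \<in> I \<Longrightarrow> i \<noteq> l \<Longrightarrow> f w i = f v i"
      using edge_coord[of w v] w(2) by (auto simp: adj_def)
    interpret Fl: weighted_graph "F l" using l factor by blast
    have "hop_dist (F l) (f u l) (f v l) \<le> hop_dist (F l) (f u l) (f w l) + 1"
      using Fl.hop_dist_triangle[of "f u l" "f w l" "f v l"] Fl.hop_dist_edge[OF l(2)]
        coord_mem V l(1) Suc.prems(2) by fastforce
    moreover have "(\<Sum>i\<in>I - {l}. hop_dist (F i) (f u i) (f w i)) =
          (\<Sum>i\<in>I - {l}. hop_dist (F i) (f u i) (f v i))"
      using l(3) by (intro sum.cong) auto
    ultimately show ?case
      using Suc.IH[OF w(1) Suc.prems(2)] by (simp add: sum.remove[OF finite_index l(1)])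
  qed
  then show "(\<Sum>i\<in>I. hop_dist (F i) (f u i) (f v i)) \<le> hop_dist G u v"
    using assms G.relpow_adj_hop_dist by blast
qed

section \<open>Layers, convex sets and boxes\<close>

text \<open>Also called the fibre of factor \<open>i\<close> through \<open>a\<close>. As a set of
  vertices of \<open>G\<close> itself it can be compared with layers of another
  factorization.\<close>

definition layer :: "'a \<Rightarrow> 'i \<Rightarrow> 'a set" where
  "layer a i = {v \<in> verts G. \<forall>k\<in>I - {i}. f v k = f a k}"

lemma layer_base: "a \<in> verts G \<Longrightarrow> a \<in> layer a i"
  by (simp add: layer_def)

text \<open>The triangle inequality holds in each coordinate, so equality of the sums forces
  equality in every coordinate; where \<open>u\<close> and \<open>v\<close> agree, \<open>x\<close>
  has to agree with them.\<close>

lemma convex_layer: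
  assumes "a \<in> verts G"
  shows "convex_verts G (layer a i)"
  unfolding convex_verts_def
proof (intro conjI ballI impI)
  fix u v x
  assume uv: "u \<in> layer a i" "v \<in> layer a i" and x: "x \<in> verts G"
    and eq: "hop_dist G u x + hop_dist G x v = hop_dist G u v"
  have V: "u \<in> verts G" "v \<in> verts G" using uv by (auto simp: layer_def)
  let ?d = "\<lambda>k y z. hop_dist (F k) (f y k) (f z k)"
  have tri: "?d k u v \<le> ?d k u x + ?d k x v" if "k \<in> I" for k
    using weighted_graph.hop_dist_triangle[OF factor] coord_mem V x that by blast
  have sum: "(\<Sum>k\<in>I. ?d k u x + ?d k x v) = (\<Sum>k\<in>I. ?d k u v)"
    using eq by (simp add: hop_dist_eq_sum V x sum.distrib)
  have "?d k u x + ?d k x v = ?d k u v" if "k \<in> I" for k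
  proof (rule ccontr)
    assume "?d k u x + ?d k x v \<noteq> ?d k u v"
    then have "?d k u v < ?d k u x + ?d k x v" using tri[OF that] by simp
    then have "(\<Sum>k\<in>I. ?d k u v) < (\<Sum>k\<in>I. ?d k u x + ?d k x v)"
      using tri that finite_index by (intro sum_strict_mono_ex1) auto
    then show False using sum by simp
  qed
  moreover have "?d k u v = 0" if "k \<in> I - {i}" for k
    using that uv weighted_graph.hop_dist_self[OF factor] by (auto simp: layer_def)
  ultimately have "?d k u x = 0" if "k \<in> I - {i}" for k
    using that by fastforce
  then have "f u k = f x k" if "k \<in> I - {i}" for k
    using weighted_graph.hop_dist_eq_0_iff[OF factor] coord_mem V x that by blast
  then show "x \<in> layer a i" using uv x by (auto simp: layer_def)
qed (auto simp: layer_def)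

text \<open>In each coordinate \<open>x\<close> equals an end point, so the triangle inequality is
  tight there, and by additivity it is tight in \<open>G\<close>.\<close>

lemma convex_mix:
  assumes "convex_verts G S" "u \<in> S" "v \<in> S" "x \<in> verts G"
    and "\<And>i. i \<in> I \<Longrightarrow> f x i = f u i \<or> f x i = f v i"
  shows "x \<in> S"
proof -
  have V: "u \<in> verts G" "v \<in> verts G" using assms(1-3) unfolding convex_verts_def by blast+
  have "hop_dist (F i) (f u i) (f x i) + hop_dist (F i) (f x i) (f v i) =
      hop_dist (F i) (f u i) (f v i)" if "i \<in> I" for i
    using assms(5)[OF that] weighted_graph.hop_dist_self[OF factor[OF that]] by auto
  then have "hop_dist G u x + hop_dist G x v = hop_dist G u v"
    using V assms(4) by (simp add: hop_dist_eq_sum flip: sum.distrib)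
  then show ?thesis using assms(1-4) unfolding convex_verts_def by blast
qed

text \<open>Members of \<open>S\<close> are corrected towards \<open>x\<close> one coordinate at a
  time: a member \<open>w\<close> that is right on \<open>K\<close> is mixed with a member
  \<open>w'\<close> that is right at \<open>k\<close>.\<close>

lemma convex_box:
  assumes S: "convex_verts G S" "S \<noteq> {}" and x: "x \<in> verts G"
    and coords: "\<And>i. i \<in> I \<Longrightarrow> f x i \<in> (\<lambda>v. f v i) ` S"
  shows "x \<in> S"
proof -
  have "\<exists>w\<in>S. \<forall>i\<in>K. f w i = f x i" if "K \<subseteq> I" for K
    using finite_subset[OF that finite_index] that
  proof (induction K)
    case empty
    then show ?case using S by auto
  next
    case (insert k K)
    then obtain w where w: "w \<in> S" "\<forall>i\<in>K. f w i = f x i" by auto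
    obtain w' where w': "w' \<in> S" "f w' k = f x k" using coords[of k] insert by force
    have V: "w \<in> verts G" "w' \<in> verts G" using S(1) w(1) w'(1) unfolding convex_verts_def by blast+
    obtain y where y: "y \<in> verts G" "\<And>i. i \<in> I \<Longrightarrow> f y i = (if i = k then f w' i else f w i)"
      using vertex_with_coords[of "\<lambda>i. if i = k then f w' i else f w i"] coord_mem[OF V(1)]
        coord_mem[OF V(2)] by metis
    have "y \<in> S" using convex_mix[OF S(1) w(1) w'(1) y(1)] y(2) by auto
    moreover have "\<forall>i\<in>insert k K. f y i = f x i" using y(2) w w' insert by auto
    ultimately show ?case by blast
  qed
  then obtain w where w: "w \<in> S" "\<forall>i\<in>I. f w i = f x i" by blast
  moreover have "w \<in> verts G" using S(1) w(1) unfolding convex_verts_def by blast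
  ultimately have "w = x" using coord_eqI x by blast
  then show ?thesis using w by simp
qed

text \<open>The coordinate map is kept and each factor shrinks to the projection of
  \<open>S\<close>; that \<open>S\<close> fills the whole product of its projections is
  \<open>convex_box\<close>.\<close>

lemma product_coordinates_convex:
  assumes S: "convex_verts G S" and ne: "S \<noteq> {}"
  shows "product_coordinates (induced_subgraph G S) I
    (\<lambda>i. induced_subgraph (F i) ((\<lambda>v. f v i) ` S)) f"
proof -
  interpret S: weighted_graph "induced_subgraph G S"
    using S ne by (rule G.weighted_graph_convex)
  have SV: "S \<subseteq> verts G" using S by (simp add: convex_verts_def)
  show ?thesis
  proof (intro product_coordinates.intro product_coordinates_axioms.intro)
    show "weighted_graph (induced_subgraph G S)" by (rule S.weighted_graph_axioms)
    show "finite I" by (rule finite_index)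
  next
    fix i assume i: "i \<in> I"
    interpret Fi: weighted_graph "F i" using factor i by blast
    let ?T = "induced_subgraph (F i) ((\<lambda>v. f v i) ` S)"
    have "(f u i, f v i) \<in> (adj ?T)\<^sup>*" if "(u, v) \<in> (adj (induced_subgraph G S))\<^sup>*" for u v
      using that
    proof (induction rule: rtrancl_induct)
      case (step v w)
      then have vw: "{v, w} \<in> edges G" "v \<in> S" "w \<in> S" by (auto simp: adj_def)
      obtain l where l: "l \<in> I" "{f v l, f w l} \<in> edges (F l)"
          "\<And>i. i \<in> I \<Longrightarrow> i \<noteq> l \<Longrightarrow> f v i = f w i"
        using edge_coord[OF vw(1)] by blast
      \<comment> \<open>An edge inside \<open>S\<close> projects to an edge or to a single vertex,
        so connectedness passes from \<open>S\<close> to the projection.\<close>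
      have "f v i = f w i \<or> (f v i, f w i) \<in> adj ?T"
        using l i vw by (cases "i = l") (auto simp: adj_def)
      then show ?case using step.IH by (metis rtrancl.rtrancl_into_rtrancl)
    qed simp
    moreover have "(u, v) \<in> (adj (induced_subgraph G S))\<^sup>*" if "u \<in> S" "v \<in> S" for u v
      using S.connected[of u v] that is_path_imp_rtrancl_adj by fastforce
    ultimately show "weighted_graph ?T"
      using SV ne coord_mem i by (intro Fi.weighted_graph_induced_subgraph) auto
  next
    have inj: "inj_on f S" using bij SV by (auto simp: bij_betw_def intro: inj_on_subset)
    have "f ` S = (\<Pi>\<^sub>E i\<in>I. (\<lambda>v. f v i) ` S)"
    proof (intro equalityI subsetI)
      fix y assume y: "y \<in> (\<Pi>\<^sub>E i\<in>I. (\<lambda>v. f v i) ` S)"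
      then have "y \<in> (\<Pi>\<^sub>E i\<in>I. verts (F i))" using SV coord_mem by (fastforce simp: PiE_iff)
      then have "y \<in> f ` verts G" using bij by (simp add: bij_betw_def)
      then obtain x where x: "x \<in> verts G" "y = f x" by blast
      then have "x \<in> S" using convex_box[OF S ne] y by (auto simp: PiE_iff)
      then show "y \<in> f ` S" using x by blast
    next
      fix y assume "y \<in> f ` S"
      then obtain x where x: "x \<in> S" "y = f x" by blast
      then have "f x \<in> (\<Pi>\<^sub>E i\<in>I. verts (F i))" using bij SV by (auto simp: bij_betw_def)
      then show "y \<in> (\<Pi>\<^sub>E i\<in>I. (\<lambda>v. f v i) ` S)" using x by (auto simp: PiE_iff)
    qed
    then show "bij_betw f (verts (induced_subgraph G S))
        (\<Pi>\<^sub>E i\<in>I. verts (induced_subgraph (F i) ((\<lambda>v. f v i) ` S)))"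
      using inj by (simp add: bij_betw_def)
  qed (use SV edge_iff weight_eq in \<open>auto simp: subset_iff\<close>)
qed

text \<open>Projection to coordinate \<open>i\<close> is the isomorphism: the other coordinates are
  frozen at those of \<open>a\<close>, so \<open>i\<close> alone can carry an edge of the
  layer.\<close>

lemma graph_iso_layer:
  assumes a: "a \<in> verts G" and i: "i \<in> I"
  shows "induced_subgraph G (layer a i) \<simeq>\<^sub>g F i"
proof -
  interpret Fi: weighted_graph "F i" using factor i by blast
  let ?L = "layer a i"
  have L: "u \<in> verts G" "f u k = f a k" if "u \<in> ?L" "k \<in> I" "k \<noteq> i" for u k
    using that by (auto simp: layer_def)
  have LV: "u \<in> verts G" if "u \<in> ?L" for u using that by (auto simp: layer_def)
  have "bij_betw (\<lambda>v. f v i) ?L (verts (F i))"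
  proof (rule bij_betwI')
    fix u v assume uv: "u \<in> ?L" "v \<in> ?L"
    have "u = v" if "f u i = f v i"
    proof (rule coord_eqI)
      show "f u k = f v k" if "k \<in> I" for k
        using \<open>f u i = f v i\<close> L(2) uv that by (cases "k = i") auto
    qed (use uv LV in auto)
    then show "f u i = f v i \<longleftrightarrow> u = v" by blast
  next
    fix x assume x: "x \<in> verts (F i)"
    obtain w where w: "w \<in> verts G" "\<And>k. k \<in> I \<Longrightarrow> f w k = (if k = i then x else f a k)"
      using vertex_with_coords[of "\<lambda>k. if k = i then x else f a k"] coord_mem[OF a] x by metis
    have "w \<in> ?L" "x = f w i" using w i by (auto simp: layer_def)
    then show "\<exists>w\<in>?L. x = f w i" by blast
  qed (use LV coord_mem i in blast)
  moreover have E: "{u, v} \<in> edges G \<longleftrightarrow> {f u i, f v i} \<in> edges (F i)"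
    if uv: "u \<in> ?L" "v \<in> ?L" for u v
  proof
    assume "{u, v} \<in> edges G"
    then obtain l where l: "l \<in> I" "{f u l, f v l} \<in> edges (F l)"
      using edge_coord by blast
    have "f u l \<noteq> f v l" using weighted_graph.edgeD(3)[OF factor] l by blast
    then have "l = i" using L(2) uv l(1) by metis
    then show "{f u i, f v i} \<in> edges (F i)" using l by simp
  next
    assume "{f u i, f v i} \<in> edges (F i)"
    moreover have "\<forall>k\<in>I - {i}. f u k = f v k" using L(2) uv by simp
    ultimately show "{u, v} \<in> edges G" using edge_iff[of u v] LV uv i by blast
  qed
  ultimately show ?thesis
    unfolding graph_iso_def using weight_eq i by (intro exI[of _ "\<lambda>v. f v i"]) auto
qed

lemma layer_Int:
  assumes "a \<in> verts G" "i \<noteq> k"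
  shows "layer a i \<inter> layer a k = {a}"
proof (intro equalityI subsetI)
  fix v assume "v \<in> layer a i \<inter> layer a k"
  then have "v = a" using assms by (intro coord_eqI) (auto simp: layer_def)
  then show "v \<in> {a}" by simp
qed (use assms layer_base in auto)

lemma is_K1_factor_if_layer_trivial:
  assumes "a \<in> verts G" "i \<in> I" "layer a i = {a}"
  shows "is_K1 (F i)"
  using graph_iso_card_verts[OF graph_iso_layer[OF assms(1,2)]] assms(3) by (simp add: is_K1_def)

end

section \<open>Prime graphs\<close>

lemma product_coordinates_reindex:
  assumes "product_coordinates G I F f" and "J \<subseteq> I" and b: "bij_betw b K J"
    and triv: "\<And>i. i \<in> I - J \<Longrightarrow> is_K1 (F i)"
    and e: "\<And>i. i \<in> J \<Longrightarrow> inj_on (e i) (verts (F i))"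
  shows "product_coordinates G K (\<lambda>k. map_graph (e (b k)) (F (b k)))
    (\<lambda>v. \<lambda>k\<in>K. e (b k) (f v (b k)))"
proof -
  interpret product_coordinates G I F f by fact
  let ?F = "\<lambda>k. map_graph (e (b k)) (F (b k))"
  let ?f = "\<lambda>v. \<lambda>k\<in>K. e (b k) (f v (b k))"
  have bJ: "b k \<in> J" "b k \<in> I" if "k \<in> K" for k
    using b that assms(2) by (auto simp: bij_betw_def)
  have triv_eq: "f u i = f v i" if "i \<in> I - J" "u \<in> verts G" "v \<in> verts G" for i u v
    using is_K1_iff_eq[of "f u i" "F i"] triv[OF that(1)] coord_mem[of u i] coord_mem[of v i] that
    by auto
  have f_eq: "?f u k = ?f v k \<longleftrightarrow> f u (b k) = f v (b k)"
    if "k \<in> K" "u \<in> verts G" "v \<in> verts G" for k u v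
    using inj_on_eq_iff[OF e[OF bJ(1)]] coord_mem bJ(2) that by simp
  have F_edge: "{?f u k, ?f v k} \<in> edges (?F k) \<longleftrightarrow> {f u (b k), f v (b k)} \<in> edges (F (b k))"
    if "k \<in> K" "u \<in> verts G" "v \<in> verts G" for k u v
    using map_graph_edge_iff[OF factor[OF bJ(2)] e[OF bJ(1)]] coord_mem bJ(2) that by simp
  show ?thesis
  proof (intro product_coordinates.intro product_coordinates_axioms.intro)
    show "weighted_graph G" by (rule G.weighted_graph_axioms)
    show "finite K" using b assms(2) finite_index by (metis bij_betw_finite finite_subset)
  next
    fix k assume "k \<in> K"
    then show "weighted_graph (?F k)" using bJ factor e by (intro weighted_graph_map_graph) auto
  next
    show "bij_betw ?f (verts G) (\<Pi>\<^sub>E k\<in>K. verts (?F k))"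
    proof (rule bij_betwI')
      fix u v assume uv: "u \<in> verts G" "v \<in> verts G"
      have "u = v" if "?f u = ?f v"
      proof (rule coord_eqI[OF uv])
        fix i assume i: "i \<in> I"
        show "f u i = f v i"
        proof (cases "i \<in> J")
          case True
          then obtain k where "k \<in> K" "i = b k" using b by (auto simp: bij_betw_def)
          then show ?thesis using f_eq[OF _ uv, of k] that by metis
        qed (use triv_eq uv i in blast)
      qed
      then show "?f u = ?f v \<longleftrightarrow> u = v" by blast
    next
      fix u assume "u \<in> verts G"
      then show "?f u \<in> (\<Pi>\<^sub>E k\<in>K. verts (?F k))"
        using coord_mem bJ(2) by (auto simp: map_graph_def)
    next
      fix y assume y: "y \<in> (\<Pi>\<^sub>E k\<in>K. verts (?F k))"
      \<comment> \<open>Preimage of \<open>y\<close>: at \<open>i\<close> in \<open>J\<close> the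
        coordinate is dictated by the only \<open>k\<close> with \<open>b k = i\<close>; a dropped
        coordinate takes any vertex of its factor.\<close>
      have "\<forall>i\<in>I. \<exists>x\<in>verts (F i). \<forall>k\<in>K. i = b k \<longrightarrow> e i x = y k"
      proof
        fix i assume i: "i \<in> I"
        show "\<exists>x\<in>verts (F i). \<forall>k\<in>K. i = b k \<longrightarrow> e i x = y k"
        proof (cases "i \<in> J")
          case True
          then obtain k where k: "k \<in> K" "i = b k" using b by (auto simp: bij_betw_def)
          then obtain x where "x \<in> verts (F i)" "y k = e i x"
            using y by (auto simp: map_graph_def PiE_iff)
          moreover have "k' = k" if "k' \<in> K" "i = b k'" for k'
            using b k that by (auto simp: bij_betw_def inj_on_def)
          ultimately show ?thesis by metis
        next
          case False
          then show ?thesis using weighted_graph.verts_nonempty[OF factor[OF i]] bJ(1) by blast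
        qed
      qed
      then obtain x where x: "\<And>i. i \<in> I \<Longrightarrow> x i \<in> verts (F i)"
          "\<And>i k. i \<in> I \<Longrightarrow> k \<in> K \<Longrightarrow> i = b k \<Longrightarrow> e i (x i) = y k" by metis
      obtain u where u: "u \<in> verts G" "\<And>i. i \<in> I \<Longrightarrow> f u i = x i"
        using vertex_with_coords x(1) by blast
      have "y = ?f u"
        using y u(2) x(2) bJ(2) by (auto simp: PiE_iff extensional_def restrict_def)
      then show "\<exists>u\<in>verts G. y = ?f u" using u by blast
    qed
  next
    fix u v assume uv: "u \<in> verts G" "v \<in> verts G"
    show "{u, v} \<in> edges G \<longleftrightarrow>
      (\<exists>k\<in>K. {?f u k, ?f v k} \<in> edges (?F k) \<and> (\<forall>i\<in>K - {k}. ?f u i = ?f v i))"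
    proof
      assume "{u, v} \<in> edges G"
      then obtain l where l: "l \<in> I" "{f u l, f v l} \<in> edges (F l)"
          "\<And>i. i \<in> I \<Longrightarrow> i \<noteq> l \<Longrightarrow> f u i = f v i"
        using edge_coord by blast
      have "f u l \<noteq> f v l" using weighted_graph.edgeD(3)[OF factor] l by blast
      then have "l \<in> J" using triv_eq uv l(1) by blast
      then obtain k where k: "k \<in> K" "l = b k" using b by (auto simp: bij_betw_def)
      have "?f u i = ?f v i" if "i \<in> K - {k}" for i
      proof -
        have "b i \<noteq> l" using that k b by (auto simp: bij_betw_def inj_on_def)
        then show ?thesis using l(3) bJ(2) that f_eq uv by blast
      qed
      then show "\<exists>k\<in>K. {?f u k, ?f v k} \<in> edges (?F k) \<and> (\<forall>i\<in>K - {k}. ?f u i = ?f v i)"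
        using F_edge[OF k(1) uv] l k by blast
    next
      assume "\<exists>k\<in>K. {?f u k, ?f v k} \<in> edges (?F k) \<and> (\<forall>i\<in>K - {k}. ?f u i = ?f v i)"
      then obtain k where k: "k \<in> K" "{?f u k, ?f v k} \<in> edges (?F k)"
          "\<And>i. i \<in> K - {k} \<Longrightarrow> ?f u i = ?f v i" by blast
      have "f u i = f v i" if i: "i \<in> I - {b k}" for i
      proof (cases "i \<in> J")
        case True
        then obtain k' where "k' \<in> K" "i = b k'" using b by (auto simp: bij_betw_def)
        then show ?thesis using f_eq[OF _ uv, of k'] k(3)[of k'] i by auto
      qed (use triv_eq uv i in blast)
      then show "{u, v} \<in> edges G"
        using edge_iff[OF uv] F_edge[OF k(1) uv] k(2) bJ(2)[OF k(1)] by blast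
    qed
  next
    fix u v k assume uv: "{u, v} \<in> edges G" and k: "k \<in> K" "{?f u k, ?f v k} \<in> edges (?F k)"
    note V = G.edgeD(1,2)[OF uv]
    have "weight (?F k) {?f u k, ?f v k} = weight (?F k) (e (b k) ` {f u (b k), f v (b k)})"
      using k(1) by simp
    also have "\<dots> = weight (F (b k)) {f u (b k), f v (b k)}"
      using coord_mem V bJ k(1) e by (intro map_graph_weight) auto
    also have "\<dots> = weight G {u, v}"
      using weight_eq[OF uv bJ(2)[OF k(1)]] F_edge[OF k(1) V] k(2) by simp
    finally show "weight (?F k) {?f u k, ?f v k} = weight G {u, v}" .
  qed
qed

text \<open>The form in which primality is used. Some nontrivial factor is isomorphic to
  \<open>P\<close>; having as many vertices as the whole product, it leaves a single vertex for each
  of the others. Arguing by contradiction avoids the case where dropping trivial factors leaves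
  nothing.\<close>

lemma prime_graph_product:
  assumes prime: "prime_graph P" and "product_coordinates P I F f" and "I \<noteq> {}"
  shows "\<exists>j\<in>I. \<forall>k\<in>I - {j}. is_K1 (F k)"
proof (rule ccontr)
  interpret product_coordinates P I F f by fact
  assume no: "\<not> ?thesis"
  define J where "J = {i \<in> I. \<not> is_K1 (F i)}"
  have J: "J \<subseteq> I" "finite J" using finite_index by (auto simp: J_def)
  \<comment> \<open>Used twice: it makes \<open>J\<close> nonempty, and at the end it yields a
    nontrivial factor besides the one isomorphic to \<open>P\<close>.\<close>
  have two: "\<exists>k\<in>J. k \<noteq> j" if "j \<in> I" for j
    using no that by (auto simp: J_def)
  obtain b where b: "bij_betw b {1..card J} J"
    using ex_bij_betw_nat_finite_1[OF J(2)] by blast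
  have "\<exists>e :: 'c \<Rightarrow> nat. inj_on e (verts (F i))" if "i \<in> I" for i
    using finite_imp_inj_to_nat_seg weighted_graph.finite_verts[OF factor[OF that]] by blast
  then obtain e :: "'b \<Rightarrow> 'c \<Rightarrow> nat" where e: "\<And>i. i \<in> I \<Longrightarrow> inj_on (e i) (verts (F i))"
    by metis
  let ?X = "\<lambda>k. map_graph (e (b k)) (F (b k))"
  interpret X: product_coordinates P "{1..card J}" ?X "\<lambda>v. \<lambda>k\<in>{1..card J}. e (b k) (f v (b k))"
    using b e J by (intro product_coordinates_reindex[OF assms(2)]) (auto simp: J_def)
  have bJ: "b k \<in> J" if "k \<in> {1..card J}" for k using b that by (auto simp: bij_betw_def)
  have card_X: "card (verts (?X k)) = card (verts (F (b k)))" if "k \<in> {1..card J}" for k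
    using e bJ[OF that] J by (auto simp: map_graph_def card_image)
  have "1 \<le> card J" 
    using two assms(3) J by (metis card_gt_0_iff ex_in_conv less_eq_Suc_le One_nat_def)
  moreover have "\<not> is_K1 (?X k)" if "k \<in> {1..card J}" for k
    using card_X[OF that] bJ[OF that] by (simp add: is_K1_def J_def)
  ultimately have "is_factorization P (card J) ?X"
    unfolding is_factorization_def using X.factor X.graph_iso_cart_prod by blast
  then obtain k where k: "k \<in> {1..card J}" "?X k \<simeq>\<^sub>g P"
    using prime unfolding prime_graph_def by blast
  let ?c = "\<lambda>i. card (verts (F i))"
  have pos: "0 < ?c i" if "i \<in> I" for i
    using weighted_graph.finite_verts[OF factor[OF that]]
      weighted_graph.verts_nonempty[OF factor[OF that]] by (simp add: card_gt_0_iff)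
  have bI: "b k \<in> I" using bJ[OF k(1)] J by blast
  have "?c (b k) = (\<Prod>i\<in>I. ?c i)"
    using graph_iso_card_verts[OF k(2)] card_X[OF k(1)] card_verts by simp
  also have "\<dots> = ?c (b k) * (\<Prod>i\<in>I - {b k}. ?c i)"
    by (rule prod.remove[OF finite_index bI])
  finally have "(\<Prod>i\<in>I - {b k}. ?c i) = 1" using pos[OF bI] by simp
  then have "?c i = 1" if "i \<in> I - {b k}" for i
    using that finite_index by (metis finite_Diff prod_eq_1_iff)
  then show False using two[OF bI] by (auto simp: J_def is_K1_def)
qed

text \<open>The layer is convex, hence a product of its projections to the coordinates
  \<open>J\<close>. It is a copy of the prime graph \<open>F i\<close>, so all projections but one
  are single vertices, and \<open>a\<close> lies in the layer.\<close>

lemma prime_layer_subset: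
  assumes "product_coordinates G I F f" "product_coordinates G J H h" "J \<noteq> {}"
    and a: "a \<in> verts G" and i: "i \<in> I" and prime: "prime_graph (F i)"
  shows "\<exists>j\<in>J. product_coordinates.layer G I f a i \<subseteq> product_coordinates.layer G J h a j"
proof -
  interpret F: product_coordinates G I F f by fact
  interpret H: product_coordinates G J H h by fact
  let ?L = "F.layer a i"
  let ?X = "\<lambda>j. induced_subgraph (H j) ((\<lambda>v. h v j) ` ?L)"
  have L: "convex_verts G ?L" "?L \<noteq> {}"
    using F.convex_layer[OF a] F.layer_base[OF a] by auto
  interpret X: product_coordinates "induced_subgraph G ?L" J ?X h
    using L by (rule H.product_coordinates_convex)
  \<comment> \<open>Primality is assumed of \<open>F i\<close> and not of the layer, so the product
    structure is carried over along the isomorphism.\<close>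
  have "F i \<simeq>\<^sub>g cart_prod J ?X"
    using graph_iso_sym[OF F.graph_iso_layer[OF a i]] X.graph_iso_cart_prod
    by (rule graph_iso_trans)
  then obtain g where "product_coordinates (F i) J ?X g"
    using product_coordinates_if_graph_iso[of "F i" J ?X] F.factor[OF i] X.finite_index X.factor
    by blast
  then obtain j where j: "j \<in> J" "\<And>k. k \<in> J - {j} \<Longrightarrow> is_K1 (?X k)"
    using prime_graph_product[OF prime _ assms(3)] by blast
  have "v \<in> H.layer a j" if v: "v \<in> ?L" for v
  proof -
    have "h v k = h a k" if "k \<in> J - {j}" for k
      using is_K1_iff_eq[of "h a k" "?X k"] j(2)[OF that] F.layer_base[OF a] v by auto
    then show ?thesis using v by (auto simp: H.layer_def F.layer_def)
  qed
  then show ?thesis using j(1) by blast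
qed

section \<open>Comparison of two factorizations\<close>

lemma factorization_coordinates:
  assumes "weighted_graph G" "is_factorization G m F"
  obtains f where "product_coordinates G {1..m} F f"
proof -
  have "\<And>i. i \<in> {1..m} \<Longrightarrow> weighted_graph (F i)" "G \<simeq>\<^sub>g cart_prod {1..m} F"
    using assms(2) by (auto simp: is_factorization_def)
  then show ?thesis
    using product_coordinates_if_graph_iso[OF assms(1) finite_atLeastAtMost] that by blast
qed

text \<open>Layers in different directions share only \<open>a\<close>, so the inclusion would
  shrink the layer to \<open>a\<close> and make \<open>F i\<close> a K1. A factorization admits K1
  only for \<open>m = 1\<close>, where there is just one direction.\<close>

lemma layer_roundtrip:
  assumes F: "is_factorization G m F" and "product_coordinates G {1..m} F f"
    and a: "a \<in> verts G" and i: "i \<in> {1..m}" and k: "k \<in> {1..m}"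
    and sub: "product_coordinates.layer G {1..m} f a i \<subseteq> product_coordinates.layer G {1..m} f a k"
  shows "k = i"
proof (rule ccontr)
  interpret product_coordinates G "{1..m}" F f by fact
  assume "k \<noteq> i"
  then have "layer a i = {a}"
    using layer_Int[OF a] sub by blast
  then have "is_K1 (F i)" using is_K1_factor_if_layer_trivial a i by blast
  then have "m = 1" using F i by (auto simp: is_factorization_def)
  then show False using \<open>k \<noteq> i\<close> i k by simp
qed

theorem theorem1p5:
  fixes G :: "'a wgraph"
    and F :: "nat \<Rightarrow> 'b wgraph" and H :: "nat \<Rightarrow> 'c wgraph"
    and m n :: nat
  assumes "weighted_graph G" and "minimal_graph G"
    and "is_factorization G m F" and "\<forall>i\<in>{1..m}. prime_graph (F i)"
    and "is_factorization G n H" and "\<forall>j\<in>{1..n}. prime_graph (H j)"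
  shows "\<exists>\<pi>. bij_betw \<pi> {1..m} {1..n} \<and> (\<forall>i\<in>{1..m}. F i \<simeq>\<^sub>g H (\<pi> i))"
proof -
  interpret G: weighted_graph G by fact
  obtain a where a: "a \<in> verts G" using G.verts_nonempty by blast
  obtain f where f: "product_coordinates G {1..m} F f"
    using factorization_coordinates assms(1,3) by blast
  obtain h where h: "product_coordinates G {1..n} H h"
    using factorization_coordinates assms(1,5) by blast
  interpret F: product_coordinates G "{1..m}" F f by fact
  interpret H: product_coordinates G "{1..n}" H h by fact
  have ne: "{1..m} \<noteq> {}" "{1..n} \<noteq> {}" using assms(3,5) by (auto simp: is_factorization_def)
  have "\<forall>i\<in>{1..m}. \<exists>j\<in>{1..n}. F.layer a i \<subseteq> H.layer a j"
    using prime_layer_subset[OF f h ne(2) a] assms(4) by blast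
  then obtain \<pi> where \<pi>: "\<And>i. i \<in> {1..m} \<Longrightarrow> \<pi> i \<in> {1..n}"
      "\<And>i. i \<in> {1..m} \<Longrightarrow> F.layer a i \<subseteq> H.layer a (\<pi> i)"
    by metis
  have "\<forall>j\<in>{1..n}. \<exists>i\<in>{1..m}. H.layer a j \<subseteq> F.layer a i"
    using prime_layer_subset[OF h f ne(1) a] assms(6) by blast
  then obtain \<sigma> where \<sigma>: "\<And>j. j \<in> {1..n} \<Longrightarrow> \<sigma> j \<in> {1..m}"
      "\<And>j. j \<in> {1..n} \<Longrightarrow> H.layer a j \<subseteq> F.layer a (\<sigma> j)"
    by metis
  \<comment> \<open>Composing the two inclusions puts the layer of direction \<open>i\<close> inside
    the one of direction \<open>\<sigma> (\<pi> i)\<close> of the same factorization.\<close>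
  have \<sigma>\<pi>: "\<sigma> (\<pi> i) = i" if i: "i \<in> {1..m}" for i
    using layer_roundtrip[OF assms(3) f a i] \<pi>[OF i] \<sigma> by blast
  have \<pi>\<sigma>: "\<pi> (\<sigma> j) = j" if j: "j \<in> {1..n}" for j
    using layer_roundtrip[OF assms(5) h a j] \<sigma>[OF j] \<pi> by blast
  have "bij_betw \<pi> {1..m} {1..n}"
    by (rule bij_betw_byWitness[where f' = \<sigma>]) (use \<pi>(1) \<sigma>(1) \<sigma>\<pi> \<pi>\<sigma> in blast)+
  moreover have "F i \<simeq>\<^sub>g H (\<pi> i)" if i: "i \<in> {1..m}" for i
  proof -
    \<comment> \<open>Since \<open>\<sigma> (\<pi> i) = i\<close>, the chain of inclusions closes
      up; the common layer is a copy of both factors.\<close>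
    have "H.layer a (\<pi> i) = F.layer a i"
      using \<pi>[OF i] \<sigma>(2)[OF \<pi>(1)[OF i]] \<sigma>\<pi>[OF i] by auto
    then show ?thesis
      using graph_iso_trans[OF graph_iso_sym[OF F.graph_iso_layer[OF a i]]]
        H.graph_iso_layer[OF a \<pi>(1)[OF i]] by simp
  qed
  ultimately show ?thesis by blast
qed

end
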